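(* Let $G$ be a group and let $T_G$ be its Property R graph. Then: (1) For every normal subgroup $N$ of $G$ one has $N\subseteq Q(G,N)$. Consequently $T_G$ is a subgraph, with the same vertex set, of the graph $\mathcal{L}$ whose vertices are the normal subgroups of $G$ and whose edges are the inclusions $N_1\subseteq N_2$. (2) For every normal subgroup $N$ of $G$ the following are equivalent: $N=Q(G,N)$; $G/N$ is abelian; the vertex $N$ of $T_G$ has a self-loop. Moreover, $T_G$ has no cycles other than self-loops, and $G/N$ is abelian if and only if $G'\subseteq N$. (3) $G$ has Property R if and only if the vertex of $T_G$ corresponding to the whole group $G$ is isolated. Indeed, a normal subgroup $N$ of $G$ with $(G/N)'=G/N$ gives a directed edge $N\to G$ of $T_G$. (4) The automorphism group $\operatorname{Aut}(G)$ acts on $T_G$: if $N_1\to N_2$ is an edge of $T_G$ and $f\in\operatorname{Aut}(G)$, then $f(N_1)\to f(N_2)$ is also an edge of $T_G$. (5) Every edge of $T_G$ has the form $N\to Q(G,N)$ for a normal subgroup $N$ of $G$, and the stabilizer of this edge under the action of $\operatorname{Aut}(G)$ on $T_G$ equals the stabilizer of $N$ under the action of $\operatorname{Aut}(G)$ on subgroups of $G$.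
   Context: For a group $H$, $H'=[H,H]$ is the derived subgroup. For a normal subgroup $N$ of $G$, $Q(G,N)$ is the preimage of $[G/N,G/N]$ under the quotient map $G\to G/N$. The Property R graph $T_G$ is the directed graph (self-loops allowed) whose vertices are the normal subgroups of $G$, with a directed edge $N_1\to N_2$ if and only if $N_2=Q(G,N_1)$. The group $G$ has Property R if $(G/N)'\neq G/N$ for every proper normal subgroup $N$ of $G$. A vertex is called isolated here if no edge of the graph joins it to a different vertex (a self-loop at the vertex is permitted). "Cycle" in (2) may be read in the undirected sense (and so also covers directed cycles). $\operatorname{Aut}(G)$ acts on subgroups by $H\mapsto f(H)$; the stabilizer of an edge $N_1\to N_2$ is the set of $f\in\operatorname{Aut}(G)$ with $f(N_1)=N_1$ and $f(N_2)=N_2$. *)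

theory Defs
  imports "HOL-Algebra.Generated_Groups" "HOL-Algebra.Bij" "HOL-Algebra.Group_Action"
    "Graph_Theory.Graph_Theory"
begin

definition derived_preimage :: "('a, 'b) monoid_scheme \<Rightarrow> 'a set \<Rightarrow> 'a set" where
  "derived_preimage G N =
     {x \<in> carrier G. N #>\<^bsub>G\<^esub> x \<in> derived (G Mod N) (carrier (G Mod N))}"

definition property_R :: "('a, 'b) monoid_scheme \<Rightarrow> bool" where
  "property_R G \<longleftrightarrow>
     (\<forall>N. N \<lhd> G \<and> N \<noteq> carrier G \<longrightarrow>
        derived (G Mod N) (carrier (G Mod N)) \<noteq> carrier (G Mod N))"

definition property_R_graph ::
    "('a, 'b) monoid_scheme \<Rightarrow> ('a set, 'a set \<times> 'a set) pre_digraph" where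
  "property_R_graph G =
     \<lparr>verts = {N. N \<lhd> G},
      arcs = {(N1, N2). N1 \<lhd> G \<and> N2 \<lhd> G \<and> N2 = derived_preimage G N1},
      tail = fst, head = snd\<rparr>"

definition normal_inclusion_graph ::
    "('a, 'b) monoid_scheme \<Rightarrow> ('a set, 'a set \<times> 'a set) pre_digraph" where
  "normal_inclusion_graph G =
     \<lparr>verts = {N. N \<lhd> G},
      arcs = {(N1, N2). N1 \<lhd> G \<and> N2 \<lhd> G \<and> N1 \<subseteq> N2},
      tail = fst, head = snd\<rparr>"

text \<open>Self-loops at the vertex are permitted.\<close>

definition isolated_vertex :: "('a, 'b) pre_digraph \<Rightarrow> 'a \<Rightarrow> bool" where
  "isolated_vertex D v \<longleftrightarrow>
     v \<in> verts D \<and> \<not> (\<exists>w. w \<noteq> v \<and> (v \<rightarrow>\<^bsub>D\<^esub> w \<or> w \<rightarrow>\<^bsub>D\<^esub> v))"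

text \<open>
  Cycles that may traverse each arc in either direction. The arcs have to be distinct, so that
  going back and forth along one arc is not a cycle, whereas two opposite arcs between distinct
  vertices form a cycle of length 2 and a self-loop forms a cycle of length 1.
\<close>

definition undirected_cycle :: "('a, 'b) pre_digraph \<Rightarrow> 'a list \<Rightarrow> 'b list \<Rightarrow> bool" where
  "undirected_cycle D vs es \<longleftrightarrow>
     es \<noteq> [] \<and> length vs = length es \<and> distinct vs \<and> distinct es \<and> set es \<subseteq> arcs D \<and>
     (\<forall>i < length es.
        {tail D (es ! i), head D (es ! i)} = {vs ! i, vs ! (Suc i mod length es)})"

definition edge_stabilizer ::
    "('a, 'b) monoid_scheme \<Rightarrow> 'a set \<Rightarrow> 'a set \<Rightarrow> ('a \<Rightarrow> 'a) set" where
  "edge_stabilizer G N1 N2 = {f \<in> carrier (AutoGroup G). f ` N1 = N1 \<and> f ` N2 = N2}"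

end

theory Submission
  imports Defs "HOL-Algebra.SndIsomorphismGrp"
begin

text \<open>
  The image of \<open>[G, G]\<close> in \<open>G / N\<close> is the derived subgroup of \<open>G / N\<close>, so
  \<open>Q(G, N) = N [G, G]\<close>. Hence \<open>Q(G, N)\<close> contains \<open>N\<close> and \<open>[G, G]\<close>, the fixed points of
  \<open>Q(G, -)\<close> are the normal subgroups above \<open>[G, G]\<close>, and \<open>Q(G, -)\<close> is idempotent and commutes
  with automorphisms. By idempotence \<open>T\<^sub>G\<close> is a disjoint union of stars directed towards
  their centers, with a loop at each center, so it has no cycles other than the loops.
\<close>

section \<open>Computing \<open>Q(G, N)\<close> as a product of normal subgroups\<close>

text \<open>Homomorphisms carry derived subgroups to derived subgroups of the image, and the
  projection onto the quotient is surjective.\<close>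

lemma (in group) derived_FactGroup:
  assumes "N \<lhd> G"
  shows "derived (G Mod N) (carrier (G Mod N)) = (\<lambda>x. N #> x) ` derived G (carrier G)"
proof -
  interpret normal N G by fact
  have "group_hom G (G Mod N) (\<lambda>x. N #> x)"
    using r_coset_hom_Mod factorgroup_is_group is_group
    by (simp add: group_hom_def group_hom_axioms_def)
  from group_hom.derived_img[OF this, of "carrier G"] show ?thesis
    by (simp add: carrier_FactGroup)
qed

lemma (in group) derived_preimage_eq:
  assumes "N \<lhd> G"
  shows "derived_preimage G N = N <#> derived G (carrier G)"
proof -
  interpret normal N G by fact
  let ?D = "derived G (carrier G)"
  have D: "?D \<subseteq> carrier G"
    by (simp add: derived_in_carrier)
  have "(N #> x \<in> (\<lambda>x. N #> x) ` ?D) \<longleftrightarrow> x \<in> N <#> ?D" if x: "x \<in> carrier G" for x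
  proof -
    \<comment> \<open>Equality of cosets becomes membership in one of them; the union of the cosets
      \<open>N #> d\<close> is the product set.\<close>
    have "N #> x = N #> d \<longleftrightarrow> x \<in> N #> d" if "d \<in> ?D" for d
      using that D x repr_independence[of x N d] rcos_self[of x N] is_subgroup by auto
    then show ?thesis
      by (fastforce simp: set_mult_def r_coset_def)
  qed
  moreover have "N <#> ?D \<subseteq> carrier G"
    using D subset by (simp add: set_mult_closed)
  ultimately show ?thesis
    unfolding derived_preimage_def derived_FactGroup[OF assms] by blast
qed

lemma (in group) derived_preimage_normal:
  assumes "N \<lhd> G"
  shows "derived_preimage G N \<lhd> G"
  using assms derived_self_is_normal
  by (simp add: derived_preimage_eq normal_subgroup_set_mult_closed)

lemma (in group) subset_derived_preimage:
  assumes "N \<lhd> G"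
  shows "N \<subseteq> derived_preimage G N"
proof
  fix x assume "x \<in> N"
  moreover have "\<one> \<in> derived G (carrier G)"
    by (simp add: derived_is_subgroup subgroup.one_closed)
  ultimately have "x \<otimes> \<one> \<in> N <#> derived G (carrier G)"
    unfolding set_mult_def by blast
  then show "x \<in> derived_preimage G N"
    using assms \<open>x \<in> N\<close> r_one[of x] subgroup.mem_carrier[OF normal_imp_subgroup, of N G x]
    by (simp add: derived_preimage_eq)
qed

lemma (in group) derived_subset_derived_preimage:
  assumes "N \<lhd> G"
  shows "derived G (carrier G) \<subseteq> derived_preimage G N"
proof
  fix x assume x: "x \<in> derived G (carrier G)"
  moreover have "\<one> \<in> N"
    using assms by (simp add: normal_imp_subgroup subgroup.one_closed)
  ultimately have "\<one> \<otimes> x \<in> N <#> derived G (carrier G)"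
    unfolding set_mult_def by blast
  moreover have "x \<in> carrier G"
    using x derived_in_carrier by blast
  ultimately show "x \<in> derived_preimage G N"
    using assms by (simp add: derived_preimage_eq)
qed

text \<open>If \<open>[G, G]\<close> lies in \<open>N\<close>, then \<open>N\<close> absorbs it in
  the product, being closed under multiplication; the converse holds because \<open>Q(G, N)\<close>
  always contains \<open>[G, G]\<close>.\<close>

lemma (in group) derived_preimage_fixed_iff:
  assumes "N \<lhd> G"
  shows "N = derived_preimage G N \<longleftrightarrow> derived G (carrier G) \<subseteq> N"
proof
  assume "N = derived_preimage G N"
  then show "derived G (carrier G) \<subseteq> N"
    using derived_subset_derived_preimage[OF assms] by simp
next
  interpret normal N G by fact
  assume "derived G (carrier G) \<subseteq> N"
  then have "derived_preimage G N \<subseteq> N"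
    unfolding derived_preimage_eq[OF assms] set_mult_def by auto
  then show "N = derived_preimage G N"
    using subset_derived_preimage[OF assms] by simp
qed

lemma (in group) derived_preimage_idem:
  assumes "N \<lhd> G"
  shows "derived_preimage G (derived_preimage G N) = derived_preimage G N"
  using derived_preimage_fixed_iff[OF derived_preimage_normal[OF assms]]
    derived_subset_derived_preimage[OF assms] by simp

section \<open>Abelian and perfect quotients\<close>

lemma (in group) comm_group_FactGroup_iff:
  assumes "N \<lhd> G"
  shows "comm_group (G Mod N) \<longleftrightarrow> derived G (carrier G) \<subseteq> N"
proof
  assume "comm_group (G Mod N)"
  then show "derived G (carrier G) \<subseteq> N"
    using derived_minimal[OF assms] by simp
next
  interpret normal N G by fact
  assume D: "derived G (carrier G) \<subseteq> N"
  have "(N #> x) <#> (N #> y) = (N #> y) <#> (N #> x)"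
    if x: "x \<in> carrier G" and y: "y \<in> carrier G" for x y
  proof -
    \<comment> \<open>Multiplying this commutator by \<open>y \<otimes> x\<close> gives
      \<open>x \<otimes> y\<close>, so both products lie in the same coset of
      \<open>N\<close>.\<close>
    have "x \<otimes> y \<otimes> inv x \<otimes> inv y \<in> N"
      using x y D unfolding derived_def by (blast intro: generate.incl)
    then have "x \<otimes> y \<otimes> inv x \<otimes> inv y \<otimes> (y \<otimes> x) \<in> N #> (y \<otimes> x)"
      unfolding r_coset_def by blast
    \<comment> \<open>The reversed instance of associativity exposes
      \<open>inv y \<otimes> y\<close>, which then cancels.\<close>
    also have "x \<otimes> y \<otimes> inv x \<otimes> inv y \<otimes> (y \<otimes> x) = x \<otimes> y"
      using x y by (simp add: m_assoc flip: m_assoc[of "inv y" y x])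
    finally show ?thesis
      using x y repr_independence[of "x \<otimes> y" N "y \<otimes> x"] is_subgroup by (simp add: rcos_sum)
  qed
  then show "comm_group (G Mod N)"
    by (intro group.group_comm_groupI factorgroup_is_group)
      (auto simp: carrier_FactGroup)
qed

text \<open>Every element of the quotient is a coset \<open>N #> x\<close>, so a subset of the
  quotient is everything exactly when its preimage is. This ties edges into \<open>G\<close> to
  perfect quotients.\<close>

lemma (in group) derived_preimage_eq_carrier_iff:
  assumes "N \<lhd> G"
  shows "derived_preimage G N = carrier G \<longleftrightarrow>
    derived (G Mod N) (carrier (G Mod N)) = carrier (G Mod N)"
proof -
  interpret normal N G by fact
  have "derived (G Mod N) (carrier (G Mod N)) \<subseteq> carrier (G Mod N)"
    by (simp add: group.derived_in_carrier factorgroup_is_group)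
  then show ?thesis
    by (auto simp: derived_preimage_def carrier_FactGroup)
qed

section \<open>Automorphisms acting on normal subgroups\<close>

lemma (in group) auto_imp_iso:
  "f \<in> carrier (AutoGroup G) \<Longrightarrow> f \<in> iso G G"
  by (simp add: AutoGroup_def auto_def Bij_def iso_def)

text \<open>The derived subgroup is characteristic and \<open>f\<close> respects products of
  subsets, so \<open>f\<close> can be pulled out of \<open>N <#> [G, G]\<close>.\<close>

lemma (in group) derived_preimage_iso_image:
  assumes "f \<in> iso G G" "N \<lhd> G"
  shows "derived_preimage G (f ` N) = f ` derived_preimage G N"
proof -
  have f: "group_hom G G f" and surj: "f ` carrier G = carrier G"
    using assms(1) is_group
    by (auto simp: group_hom_def group_hom_axioms_def iso_def bij_betw_def)
  interpret group_hom G G f by (fact f)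
  have N: "N \<subseteq> carrier G"
    using assms(2) by (simp add: normal_imp_subgroup subgroup.subset)
  have D: "derived G (carrier G) \<subseteq> carrier G"
    by (simp add: derived_in_carrier)
  have "f ` derived G (carrier G) = derived G (carrier G)"
    using derived_img[of "carrier G"] surj by simp
  then have "derived_preimage G (f ` N) = (f ` N) <#> (f ` derived G (carrier G))"
    using derived_preimage_eq[OF iso_normal_subgroup[OF assms(1) is_group is_group assms(2)]]
    by simp
  also have "\<dots> = f ` (N <#> derived G (carrier G))"
    using N D by (auto 0 4 simp: set_mult_def image_iff subset_iff)
  finally show ?thesis
    using derived_preimage_eq[OF assms(2)] by simp
qed

text \<open>The restriction is there because \<open>Bij\<close> consists of extensional
  functions.\<close>

lemma (in group) AutoGroup_action_normal:
  "group_action (AutoGroup G) {N. N \<lhd> G} (\<lambda>f. restrict (\<lambda>N. f ` N) {N. N \<lhd> G})"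
proof -
  let ?V = "{N. N \<lhd> G}"
  have sub: "N \<subseteq> carrier G" if "N \<lhd> G" for N
    using that by (simp add: normal_imp_subgroup subgroup.subset)
  have "restrict (\<lambda>N. f ` N) ?V \<in> Bij ?V" if f: "f \<in> carrier (AutoGroup G)" for f
  proof -
    have iso: "f \<in> iso G G"
      using f by (rule auto_imp_iso)
    then have inj: "inj_on f (carrier G)" and surj: "f ` carrier G = carrier G"
      by (auto simp: iso_def bij_betw_def)
    have "inj_on (\<lambda>N. f ` N) ?V"
      using sub by (auto intro!: inj_onI simp: inj_on_image_eq_iff[OF inj])
    moreover have "(\<lambda>N. f ` N) ` ?V = ?V"
    proof
      show "(\<lambda>N. f ` N) ` ?V \<subseteq> ?V"
        using iso_normal_subgroup[OF iso is_group is_group] by auto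
      show "?V \<subseteq> (\<lambda>N. f ` N) ` ?V"
      proof
        fix N assume "N \<in> ?V"
        then have N: "N \<lhd> G" by simp
        \<comment> \<open>The preimage of \<open>N\<close> is its image under the inverse
          isomorphism, hence normal.\<close>
        let ?g = "inv_into (carrier G) f"
        have "?g ` N \<lhd> G"
          using iso_normal_subgroup[OF iso_set_sym[OF iso] is_group is_group N] .
        moreover have "f ` ?g ` N = N"
          using sub[OF N] surj by (simp add: image_inv_into_cancel)
        ultimately show "N \<in> (\<lambda>N. f ` N) ` ?V"
          by (metis (mono_tags, lifting) image_eqI mem_Collect_eq)
      qed
    qed
    ultimately show ?thesis
      by (simp only: Bij_def bij_betw_def inj_on_restrict_eq image_restrict_eq restrict_extensional
          Int_iff mem_Collect_eq conj_assoc simp_thms)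
  qed
  moreover have "restrict (\<lambda>N. (f \<otimes>\<^bsub>AutoGroup G\<^esub> g) ` N) ?V =
      compose ?V (restrict (\<lambda>N. f ` N) ?V) (restrict (\<lambda>N. g ` N) ?V)"
    if f: "f \<in> carrier (AutoGroup G)" and g: "g \<in> carrier (AutoGroup G)" for f g
  proof
    fix N
    \<comment> \<open>The product in \<open>AutoGroup\<close> is composition restricted to
      \<open>carrier G\<close>, which contains \<open>N\<close>.\<close>
    have "(f \<otimes>\<^bsub>AutoGroup G\<^esub> g) ` N = f ` g ` N" if "N \<lhd> G"
      using f g sub[OF that]
      by (force simp: AutoGroup_def BijGroup_def auto_def compose_def)
    then show "restrict (\<lambda>N. (f \<otimes>\<^bsub>AutoGroup G\<^esub> g) ` N) ?V N =
        compose ?V (restrict (\<lambda>N. f ` N) ?V) (restrict (\<lambda>N. g ` N) ?V) N"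
      \<comment> \<open>Normality of the image under \<open>g\<close> keeps it inside the domain of
        the outer restriction.\<close>
      using iso_normal_subgroup[OF auto_imp_iso[OF g] is_group is_group]
      by (simp add: compose_def)
  qed
  ultimately show ?thesis
    using AutoGroup group_BijGroup
    by (simp add: group_action_def group_hom_def group_hom_axioms_def hom_def BijGroup_def)
qed

section \<open>Edges and cycles of the graph\<close>

lemma property_R_graph_simps:
  "verts (property_R_graph G) = {N. N \<lhd> G}"
  "arcs (property_R_graph G) = {(N1, N2). N1 \<lhd> G \<and> N2 \<lhd> G \<and> N2 = derived_preimage G N1}"
  "tail (property_R_graph G) = fst"
  "head (property_R_graph G) = snd"
  by (simp_all add: property_R_graph_def)

lemma (in group) property_R_graph_dominates_iff:
  "N1 \<rightarrow>\<^bsub>property_R_graph G\<^esub> N2 \<longleftrightarrow> N1 \<lhd> G \<and> N2 = derived_preimage G N1"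
  using derived_preimage_normal by (auto simp: arcs_ends_conv property_R_graph_simps)

lemma (in group) spanning_property_R_graph:
  "spanning (property_R_graph G) (normal_inclusion_graph G)"
  using subset_derived_preimage
  by (auto simp: spanning_def subgraph_def compatible_def wf_digraph_def
      property_R_graph_simps normal_inclusion_graph_def)

lemma (in group) property_R_graph_cycle:
  assumes "pre_digraph.cycle (property_R_graph G) p"
  shows "\<exists>N. p = [(N, N)]"
proof -
  let ?T = "property_R_graph G"
  obtain u where arcs: "set p \<subseteq> arcs ?T" and cas: "pre_digraph.cas ?T u p u"
    and dist: "distinct (tl (pre_digraph.awalk_verts ?T u p))" and "p \<noteq> []"
    using assms unfolding pre_digraph.cycle_def pre_digraph.awalk_def by blast
  then obtain e es where p: "p = e # es"
    by (cases p) auto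
  show ?thesis
  proof (cases es)
    case Nil
    then show ?thesis
      using cas p by (cases e) (simp add: pre_digraph.cas.simps property_R_graph_simps)
  next
    case (Cons e' es')
    \<comment> \<open>The second arc starts at a value of \<open>Q(G, -)\<close>, hence is a loop and repeats its vertex.\<close>
    have "tail ?T e' = head ?T e"
      using cas p Cons by (simp add: pre_digraph.cas.simps)
    then have loop: "head ?T e' = tail ?T e'"
      using arcs p Cons derived_preimage_idem by (auto simp: property_R_graph_simps)
    have "pre_digraph.cas ?T (head ?T e') es' u"
      using cas p Cons by (simp add: pre_digraph.cas.simps)
    \<comment> \<open>The vertex list of the remaining walk starts at this vertex, even if
      \<open>es'\<close> is empty, so the loop \<open>e'\<close> lists it twice.\<close>
    then have "head ?T e' \<in> set (pre_digraph.awalk_verts ?T (head ?T e') es')"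
      by (cases es') (simp_all add: pre_digraph.cas.simps pre_digraph.awalk_verts.simps)
    then have False
      using dist p Cons loop by (simp add: pre_digraph.awalk_verts.simps)
    then show ?thesis ..
  qed
qed

lemma (in group) property_R_graph_undirected_cycle:
  assumes "undirected_cycle (property_R_graph G) vs es"
  shows "\<exists>N. vs = [N] \<and> es = [(N, N)]"
proof -
  let ?n = "length es"
  have ne: "es \<noteq> []" and len: "length vs = ?n" and dvs: "distinct vs" and des: "distinct es"
    and arcs: "\<And>i. i < ?n \<Longrightarrow> es ! i \<in> arcs (property_R_graph G)"
    and ends: "\<And>i. i < ?n \<Longrightarrow>
      {fst (es ! i), snd (es ! i)} = {vs ! i, vs ! (Suc i mod ?n)}"
    using assms nth_mem[of _ es]
    by (auto simp only: undirected_cycle_def property_R_graph_simps(3,4))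
  have head: "snd (es ! i) = derived_preimage G (fst (es ! i))" and
    idem: "derived_preimage G (snd (es ! i)) = snd (es ! i)" if "i < ?n" for i
    using arcs[OF that] derived_preimage_idem by (auto simp: property_R_graph_simps)
  show ?thesis
  proof (cases "?n = 1")
    case True
    then obtain v e where "vs = [v]" "es = [e]"
      using len by (auto simp: length_Suc_conv)
    then show ?thesis
      using ends[of 0] by (cases e) auto
  next
    case False
    then have n: "?n \<ge> 2"
      using ne by (cases es) (auto simp: Suc_le_eq)
    \<comment> \<open>With at least two arcs, cyclically consecutive positions differ.\<close>
    have mod_neq: "Suc i mod ?n \<noteq> i" if "i < ?n" for i
      using that n by (cases "Suc i = ?n") auto
    have noloop: "fst (es ! i) \<noteq> snd (es ! i)" if "i < ?n" for i
    proof
      assume "fst (es ! i) = snd (es ! i)"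
      then have "vs ! i = vs ! (Suc i mod ?n)"
        using ends[OF that] by (auto simp: doubleton_eq_iff)
      then show False
        using nth_eq_iff_index_eq[OF dvs, of i "Suc i mod ?n"] mod_neq[OF that] that len ne by simp
    qed
    \<comment> \<open>The tail of a non-loop is not a value of \<open>Q(G, -)\<close>, so this arc is the only one at it,
      whereas every vertex of the cycle lies on two arcs.\<close>
    have unique: "i = j" if ij: "i < ?n" "j < ?n"
      and inc: "fst (es ! i) \<in> {fst (es ! j), snd (es ! j)}" for i j
    proof -
      have "fst (es ! i) \<noteq> snd (es ! j)"
        using head[OF ij(1)] idem[OF ij(2)] noloop[OF ij(1)] by metis
      then have "fst (es ! i) = fst (es ! j)"
        using inc by simp
      then have "es ! i = es ! j"
        using head[OF ij(1)] head[OF ij(2)] by (simp add: prod_eq_iff)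
      then show ?thesis
        using nth_eq_iff_index_eq[OF des] ij by simp
    qed
    \<comment> \<open>The tail of arc 0 must be one of its two endpoints on the cycle. The endpoint
      \<open>vs ! 1\<close> also lies on arc 1, and \<open>vs ! 0\<close> on the last arc by
      wrapping around; \<open>unique\<close> excludes both.\<close>
    have "{fst (es ! 0), snd (es ! 0)} = {vs ! 0, vs ! 1}"
      using ends[of 0] n ne by simp
    then have "fst (es ! 0) \<in> {vs ! 0, vs ! 1}"
      by (metis insertI1)
    moreover have "vs ! 1 \<in> {fst (es ! 1), snd (es ! 1)}"
      using ends[of 1] n by simp
    then have "fst (es ! 0) \<noteq> vs ! 1"
      using unique[of 0 1] n ne by auto
    moreover have "vs ! 0 \<in> {fst (es ! (?n - 1)), snd (es ! (?n - 1))}"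
      using ends[of "?n - 1"] n ne by simp
    then have "fst (es ! 0) \<noteq> vs ! 0"
      using unique[of 0 "?n - 1"] n ne by auto
    ultimately show ?thesis by simp
  qed
qed

section \<open>Property R and edge stabilizers\<close>

lemma (in group) derived_preimage_carrier:
  "derived_preimage G (carrier G) = carrier G"
  using subset_derived_preimage[OF normal_self] by (auto simp: derived_preimage_def)

text \<open>The only edge leaving \<open>G\<close> is its loop, so isolation concerns incoming
  edges; those from proper \<open>N\<close> are the perfect quotients.\<close>

lemma (in group) property_R_iff_isolated:
  "property_R G \<longleftrightarrow> isolated_vertex (property_R_graph G) (carrier G)"
proof -
  have "isolated_vertex (property_R_graph G) (carrier G) \<longleftrightarrow>
      (\<forall>N. N \<lhd> G \<and> N \<noteq> carrier G \<longrightarrow> derived_preimage G N \<noteq> carrier G)"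
    using derived_preimage_carrier normal_self
    unfolding isolated_vertex_def property_R_graph_dominates_iff property_R_graph_simps
    by (metis mem_Collect_eq)
  then show ?thesis
    using derived_preimage_eq_carrier_iff by (simp add: property_R_def)
qed

text \<open>If \<open>f\<close> fixes \<open>N\<close>, it fixes \<open>Q(G, N)\<close> too, because
  \<open>Q(G, -)\<close> commutes with automorphisms.\<close>

lemma (in group) edge_stabilizer_eq:
  assumes "N \<lhd> G"
  shows "edge_stabilizer G N (derived_preimage G N) =
    stabilizer (AutoGroup G) (\<lambda>f H. f ` H) N"
  unfolding edge_stabilizer_def stabilizer_def
  using derived_preimage_iso_image[OF auto_imp_iso assms] by (metis (lifting))

theorem theorem3:
  fixes G :: "('a, 'b) monoid_scheme"
    and T :: "('a set, 'a set \<times> 'a set) pre_digraph"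
  assumes "group G"
    and "T = property_R_graph G"
  shows
    "((\<forall>N. N \<lhd> G \<longrightarrow> N \<subseteq> derived_preimage G N) \<and>
      spanning T (normal_inclusion_graph G)) \<and>

     ((\<forall>N. N \<lhd> G \<longrightarrow>
         (N = derived_preimage G N \<longleftrightarrow> comm_group (G Mod N)) \<and>
         (comm_group (G Mod N) \<longleftrightarrow> N \<rightarrow>\<^bsub>T\<^esub> N) \<and>
         (comm_group (G Mod N) \<longleftrightarrow> derived G (carrier G) \<subseteq> N)) \<and>
      (\<forall>p. pre_digraph.cycle T p \<longrightarrow> (\<exists>N. p = [(N, N)])) \<and>
      (\<forall>vs es. undirected_cycle T vs es \<longrightarrow> (\<exists>N. vs = [N] \<and> es = [(N, N)]))) \<and>

     ((property_R G \<longleftrightarrow> isolated_vertex T (carrier G)) \<and>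
      (\<forall>N. N \<lhd> G \<and> derived (G Mod N) (carrier (G Mod N)) = carrier (G Mod N) \<longrightarrow>
         N \<rightarrow>\<^bsub>T\<^esub> (carrier G))) \<and>

     (group_action (AutoGroup G) (verts T) (\<lambda>f. restrict (\<lambda>N. f ` N) (verts T)) \<and>
      (\<forall>f \<in> carrier (AutoGroup G). \<forall>N1 N2. N1 \<rightarrow>\<^bsub>T\<^esub> N2 \<longrightarrow> (f ` N1) \<rightarrow>\<^bsub>T\<^esub> (f ` N2))) \<and>

     ((\<forall>N1 N2. N1 \<rightarrow>\<^bsub>T\<^esub> N2 \<longrightarrow>
         (\<exists>N. N \<lhd> G \<and> N1 = N \<and> N2 = derived_preimage G N)) \<and>
      (\<forall>N. N \<lhd> G \<longrightarrow>
         N \<rightarrow>\<^bsub>T\<^esub> (derived_preimage G N) \<and>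
         edge_stabilizer G N (derived_preimage G N) =
           stabilizer (AutoGroup G) (\<lambda>f H. f ` H) N))"
proof -
  interpret group G by fact
  note T = \<open>T = property_R_graph G\<close>
  note dom = property_R_graph_dominates_iff[folded T]
  have 1: "N = derived_preimage G N \<longleftrightarrow> comm_group (G Mod N)"
    "comm_group (G Mod N) \<longleftrightarrow> N \<rightarrow>\<^bsub>T\<^esub> N"
    "comm_group (G Mod N) \<longleftrightarrow> derived G (carrier G) \<subseteq> N" if "N \<lhd> G" for N
    using comm_group_FactGroup_iff[OF that] derived_preimage_fixed_iff[OF that] that
    by (simp_all add: dom)
  have 2: "N \<rightarrow>\<^bsub>T\<^esub> carrier G"
    if "N \<lhd> G" "derived (G Mod N) (carrier (G Mod N)) = carrier (G Mod N)" for N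
    using that derived_preimage_eq_carrier_iff[of N] by (simp add: dom)
  have 3: "(f ` N1) \<rightarrow>\<^bsub>T\<^esub> (f ` N2)"
    if "f \<in> carrier (AutoGroup G)" "N1 \<rightarrow>\<^bsub>T\<^esub> N2" for f N1 N2
    using that derived_preimage_iso_image iso_normal_subgroup[OF _ is_group is_group]
    by (simp add: dom auto_imp_iso)
  have 4: "group_action (AutoGroup G) (verts T) (\<lambda>f. restrict (\<lambda>N. f ` N) (verts T))"
    using AutoGroup_action_normal by (simp add: T property_R_graph_simps)
  have 5: "\<exists>N. N \<lhd> G \<and> N1 = N \<and> N2 = derived_preimage G N" if "N1 \<rightarrow>\<^bsub>T\<^esub> N2" for N1 N2
    using that by (simp add: dom)
  have 6: "N \<rightarrow>\<^bsub>T\<^esub> derived_preimage G N" if "N \<lhd> G" for N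
    using that by (simp add: dom)
  show ?thesis
    by (intro conjI allI impI ballI; (elim conjE)?)
      (rule 1 2 3 4 5 6 subset_derived_preimage spanning_property_R_graph[folded T]
        property_R_graph_cycle[folded T] property_R_graph_undirected_cycle[folded T]
        property_R_iff_isolated[folded T] edge_stabilizer_eq; assumption)+
qed

end
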